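(* Let $G$ be a cubic graph and let $C_0 \subseteq G$ be a $2$-regular subgraph. Then $G$ has a $5$-cycle double cover which contains $C_0$ if and only if both of the following hold: (1) $G$ contains a matching $M$ such that $G - M$ (the graph obtained from $G$ by deleting the edges of $M$) has a nowhere-zero $4$-flow, and (2) $G$ contains two $2$-regular subgraphs $C_1, C_2$ with $M = E(C_1) \cap E(C_2)$ and $C_0 \subseteq C_1$.
   Context: A $2$-regular subgraph of a graph is a subgraph in which every vertex has degree exactly $2$ (i.e. a vertex-disjoint union of circuits, where a circuit is a $2$-connected $2$-regular graph). A cycle double cover (CDC) of a graph $G$ with maximum degree at most $3$ is a set $\mathbf{S}$ of $2$-regular subgraphs of $G$ such that every edge of $G$ is contained in exactly two elements of $\mathbf{S}$; if $|\mathbf{S}| = k$ it is called a $k$-CDC (here, a $5$-cycle double cover means a $5$-CDC). A $2$-regular subgraph $C_0$ of $G$ is said to be contained in a CDC $\mathbf{S}$ if $C_0$ is a subgraph of one of the elements of $\mathbf{S}$.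
   Formalization: A 5-CDC is taken as a multiset of five 2-regular subgraphs, so the empty subgraph may be repeated; with five distinct members the claim fails for K_4 with C_0 a 4-circuit. Non-empty members are still distinct. *)

theory Defs
  imports "HOL-Library.Multiset" "HOL-Library.Uprod"
begin

text \<open>Finite undirected graphs, in which parallel edges and loops are allowed. The
  incidence function assigns to every edge the unordered pair of its (not necessarily
  distinct) end vertices.\<close>

record ('v, 'e) graph =
  verts :: "'v set"
  edges :: "'e set"
  ends :: "'e \<Rightarrow> 'v uprod"

definition is_graph :: "('v, 'e) graph \<Rightarrow> bool" where
  "is_graph G \<longleftrightarrow>
     finite (verts G) \<and> finite (edges G) \<and> (\<forall>e\<in>edges G. set_uprod (ends G e) \<subseteq> verts G)"

text \<open>A loop contributes 2 to the degree of its end vertex.\<close>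

definition degree :: "('v, 'e) graph \<Rightarrow> 'v \<Rightarrow> nat" where
  "degree G v =
     card {e \<in> edges G. v \<in> set_uprod (ends G e)} + card {e \<in> edges G. ends G e = Upair v v}"

definition regular :: "nat \<Rightarrow> ('v, 'e) graph \<Rightarrow> bool" where
  "regular k G \<longleftrightarrow> (\<forall>v\<in>verts G. degree G v = k)"

definition cubic_graph :: "('v, 'e) graph \<Rightarrow> bool" where
  "cubic_graph G \<longleftrightarrow> is_graph G \<and> regular 3 G"

text \<open>A subgraph carries the whole incidence function of the ambient graph, so that
  subgraphs of a given graph are equal as soon as they have the same vertices and edges.\<close>

definition subgraph :: "('v, 'e) graph \<Rightarrow> ('v, 'e) graph \<Rightarrow> bool" where
  "subgraph H G \<longleftrightarrow>
     is_graph H \<and> verts H \<subseteq> verts G \<and> edges H \<subseteq> edges G \<and> ends H = ends G"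

text \<open>The subgraph without vertices is (vacuously) a 2-regular subgraph.\<close>

definition two_regular_subgraph :: "('v, 'e) graph \<Rightarrow> ('v, 'e) graph \<Rightarrow> bool" where
  "two_regular_subgraph H G \<longleftrightarrow> subgraph H G \<and> regular 2 H"

text \<open>Multisets are used because a \<open>k\<close>-CDC may have to be filled up with several copies of
  the empty subgraph: with five pairwise distinct members, \<open>K\<^sub>4\<close> would have no 5-CDC
  containing a given circuit of length 4. In a cubic graph no non-empty 2-regular subgraph can
  occur twice, since double covering forces the three members through a vertex to use three
  different pairs of edges there.\<close>

definition cycle_double_cover :: "('v, 'e) graph \<Rightarrow> ('v, 'e) graph multiset \<Rightarrow> bool" where
  "cycle_double_cover G S \<longleftrightarrow>
     (\<forall>H\<in>#S. two_regular_subgraph H G) \<and>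
     (\<forall>e\<in>edges G. size {#H \<in># S. e \<in> edges H#} = 2)"

definition k_cdc :: "nat \<Rightarrow> ('v, 'e) graph \<Rightarrow> ('v, 'e) graph multiset \<Rightarrow> bool" where
  "k_cdc k G S \<longleftrightarrow> cycle_double_cover G S \<and> size S = k"

definition contained_in_cdc :: "('v, 'e) graph \<Rightarrow> ('v, 'e) graph multiset \<Rightarrow> bool" where
  "contained_in_cdc C S \<longleftrightarrow> (\<exists>H\<in>#S. subgraph C H)"

definition matching :: "('v, 'e) graph \<Rightarrow> 'e set \<Rightarrow> bool" where
  "matching G M \<longleftrightarrow>
     M \<subseteq> edges G \<and>
     (\<forall>e\<in>M. \<forall>v. ends G e \<noteq> Upair v v) \<and>
     (\<forall>e\<in>M. \<forall>f\<in>M. e \<noteq> f \<longrightarrow> set_uprod (ends G e) \<inter> set_uprod (ends G f) = {})"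

definition delete_edges :: "('v, 'e) graph \<Rightarrow> 'e set \<Rightarrow> ('v, 'e) graph" where
  "delete_edges G M = G\<lparr>edges := edges G - M\<rparr>"

definition orientation :: "('v, 'e) graph \<Rightarrow> ('e \<Rightarrow> 'v) \<Rightarrow> ('e \<Rightarrow> 'v) \<Rightarrow> bool" where
  "orientation G tail head \<longleftrightarrow> (\<forall>e\<in>edges G. ends G e = Upair (tail e) (head e))"

definition nowhere_zero_flow :: "nat \<Rightarrow> ('v, 'e) graph \<Rightarrow> bool" where
  "nowhere_zero_flow k G \<longleftrightarrow>
     (\<exists>tail head. \<exists>f :: 'e \<Rightarrow> int. orientation G tail head \<and>
        (\<forall>e\<in>edges G. 0 < \<bar>f e\<bar> \<and> \<bar>f e\<bar> < int k) \<and>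
        (\<forall>v\<in>verts G. (\<Sum>e | e \<in> edges G \<and> tail e = v. f e) = (\<Sum>e | e \<in> edges G \<and> head e = v. f e)))"

end

theory Submission
  imports Defs
begin

text \<open>Members of a cycle double cover are even edge sets, and in a cubic graph every even edge
  set is the edge set of a 2-regular subgraph; a nowhere-zero 4-flow is the same as a pair of even
  edge sets \<open>X\<close>, \<open>Y\<close> covering all edges. Write \<open>+\<close> for the symmetric difference.
  If \<open>A\<^sub>1, \<dots>, A\<^sub>5\<close> is a 5-CDC, put \<open>M = A\<^sub>1 \<inter> A\<^sub>2\<close>; then \<open>A\<^sub>3 + A\<^sub>4\<close> and \<open>A\<^sub>3 + A\<^sub>5\<close>
  cover exactly the edges outside \<open>M\<close>. Conversely, if \<open>X\<close> and \<open>Y\<close> cover exactly the edges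
  outside \<open>M = C\<^sub>1 \<inter> C\<^sub>2\<close> and \<open>D = C\<^sub>1 + C\<^sub>2\<close>, then
  \<open>C\<^sub>1, C\<^sub>2, X + D, Y + D, X + Y + D\<close> is a 5-CDC.\<close>

section \<open>Even edge sets\<close>

definition incidence :: "'v uprod \<Rightarrow> 'v \<Rightarrow> nat" where
  "incidence u v = of_bool (v \<in> set_uprod u) + of_bool (u = Upair v v)"

text \<open>Stated for a bare edge set and incidence function rather than for a graph, so that
  intersections and symmetric differences need no vertex set of their own.\<close>

definition set_degree :: "('e \<Rightarrow> 'v uprod) \<Rightarrow> 'e set \<Rightarrow> 'v \<Rightarrow> nat" where
  "set_degree en F v = (\<Sum>e\<in>F. incidence (en e) v)"

text \<open>These are the elements of the cycle space over the two-element field. All vertices of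
  the type are quantified over; those that meet no edge of \<open>F\<close> have degree 0.\<close>

definition even_set :: "('e \<Rightarrow> 'v uprod) \<Rightarrow> 'e set \<Rightarrow> bool" where
  "even_set en F \<longleftrightarrow> (\<forall>v. even (set_degree en F v))"

lemma incidence_Upair: "incidence (Upair a b) v = of_bool (a = v) + of_bool (b = v)"
  by (auto simp: incidence_def)

lemma degree_eq_set_degree:
  assumes "finite (edges G)"
  shows "degree G v = set_degree (ends G) (edges G) v"
  using assms
  by (simp add: degree_def set_degree_def incidence_def sum.distrib Int_def)

lemma set_degree_mono:
  assumes "finite K" "F \<subseteq> K"
  shows "set_degree en F v \<le> set_degree en K v"
  unfolding set_degree_def by (rule sum_mono2) (use assms in auto)

lemma set_degree_Diff:
  assumes "finite K" "F \<subseteq> K"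
  shows "set_degree en (K - F) v + set_degree en F v = set_degree en K v"
  unfolding set_degree_def using sum.subset_diff[OF assms(2,1)] by metis

text \<open>The degrees of \<open>F\<close> and \<open>K\<close> add up to that of the symmetric
  difference plus twice that of the intersection.\<close>

lemma even_set_sym_diff:
  assumes "finite F" "finite K" "even_set en F" "even_set en K"
  shows "even_set en (sym_diff F K)"
  unfolding even_set_def
proof
  fix v
  have "set_degree en (sym_diff F K) v = set_degree en (F - K) v + set_degree en (K - F) v"
    unfolding set_degree_def using assms by (intro sum.union_disjoint) auto
  moreover have "set_degree en (F - K) v + set_degree en (F \<inter> K) v = set_degree en F v"
    using set_degree_Diff[of F "F \<inter> K" en v] assms by (simp add: Diff_Int)
  moreover have "set_degree en (K - F) v + set_degree en (F \<inter> K) v = set_degree en K v"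
    using set_degree_Diff[of K "F \<inter> K" en v] assms by (simp add: Diff_Int)
  ultimately show "even (set_degree en (sym_diff F K) v)"
    using assms(3,4) unfolding even_set_def by (metis even_add)
qed

section \<open>Nowhere-zero 4-flows\<close>

text \<open>The induction splits off: two edges \<open>e\<close>, \<open>f\<close> that meet in a vertex are replaced by a single
  edge between their other ends.\<close>

lemma even_balanced_signing:
  fixes t h :: "'e \<Rightarrow> 'v"
  assumes "finite F" "\<forall>v. even (\<Sum>e\<in>F. of_bool (t e = v) + of_bool (h e = v) :: nat)"
  shows "\<exists>s :: 'e \<Rightarrow> int. (\<forall>e\<in>F. \<bar>s e\<bar> = 1) \<and>
           (\<forall>v. (\<Sum>e\<in>F. s e * (of_bool (t e = v) - of_bool (h e = v))) = 0)"
  using assms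
proof (induction "card F" arbitrary: F h rule: less_induct)
  case less
  show ?case
  proof (cases "F = {}")
    case False
    then obtain e where e: "e \<in> F" by blast
    show ?thesis
    proof (cases "t e = h e")
      \<comment> \<open>A loop adds 2 to the degree and nothing to the net flow, so it can be
        removed and afterwards receive either sign.\<close>
      case True
      obtain R where R: "F = insert e R" "e \<notin> R" "finite R"
        using e less.prems(1) by (metis finite_insert mk_disjoint_insert)
      have "\<forall>v. even (\<Sum>e\<in>R. of_bool (t e = v) + of_bool (h e = v) :: nat)"
        using less.prems(2) R True by (auto simp: even_add)
      then obtain s :: "'e \<Rightarrow> int" where s: "\<forall>e\<in>R. \<bar>s e\<bar> = 1"
          "\<forall>v. (\<Sum>e\<in>R. s e * (of_bool (t e = v) - of_bool (h e = v))) = 0"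
        using less.hyps[of R h] R by auto
      have "(\<Sum>x\<in>R. (s(e := 1)) x * (of_bool (t x = v) - of_bool (h x = v))) = 0" for v
        using s(2) R(2) by (subst sum.cong[OF refl, where h = "\<lambda>e. s e * (of_bool (t e = v) - of_bool (h e = v))"]) auto
      then show ?thesis
        using s(1) R True by (intro exI[of _ "s(e := 1)"]) simp
    next
      case ne: False
      \<comment> \<open>If every other edge had both or neither of its ends at \<open>h e\<close>,
        the non-loop \<open>e\<close> would make the degree there odd.\<close>
      have "\<exists>f\<in>F - {e}. t f \<noteq> h f \<and> (t f = h e \<or> h f = h e)"
      proof (rule ccontr)
        assume "\<not> ?thesis"
        then have "\<forall>f\<in>F - {e}. t f = h e \<longleftrightarrow> h f = h e" by metis
        then have "even (\<Sum>x\<in>F - {e}. of_bool (t x = h e) + of_bool (h x = h e) :: nat)"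
          by (intro dvd_sum) auto
        moreover have "even (\<Sum>x\<in>F. of_bool (t x = h e) + of_bool (h x = h e) :: nat)"
          using less.prems(2) by blast
        ultimately show False
          using sum.remove[OF less.prems(1) e, of "\<lambda>x. of_bool (t x = h e) + of_bool (h x = h e) :: nat"] ne
          by simp
      qed
      then obtain f where f: "f \<in> F" "f \<noteq> e" "t f \<noteq> h f" "t f = h e \<or> h f = h e" by blast
      obtain R where R: "F = insert e (insert f R)" "e \<notin> R" "f \<notin> R" "finite R"
      proof
        show "F = insert e (insert f (F - {e, f}))" using e f by blast
      qed (use less.prems in auto)
      \<comment> \<open>\<open>b\<close> is the far end of \<open>f\<close>, and \<sigma> tells
        whether \<open>f\<close> points away from \<open>h e\<close>. The path along
        \<open>e\<close> and \<open>f\<close> from \<open>t e\<close> to \<open>b\<close> becomes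
        the single edge \<open>e\<close> with head \<open>b\<close>.\<close>
      define b where "b = (if t f = h e then h f else t f)"
      define \<sigma> :: int where "\<sigma> = (if t f = h e then 1 else - 1)"
      define h' where "h' = h(e := b)"
      have h'R: "h' x = h x" if "x \<in> R" for x using that R by (auto simp: h'_def)
      \<comment> \<open>Splitting off lowers the degree at \<open>h e\<close> by 2 and changes no
        other degree.\<close>
      have "even (\<Sum>x\<in>insert e R. of_bool (t x = v) + of_bool (h' x = v) :: nat)" for v
      proof -
        have "(\<Sum>x\<in>R. of_bool (t x = v) + of_bool (h' x = v) :: nat) =
              (\<Sum>x\<in>R. of_bool (t x = v) + of_bool (h x = v))"
          by (rule sum.cong) (simp_all add: h'R)
        moreover have "even (\<Sum>x\<in>F. of_bool (t x = v) + of_bool (h x = v) :: nat)"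
          using less.prems(2) by blast
        ultimately show ?thesis
          using R f by (auto simp: h'_def b_def split: if_splits)
      qed
      then obtain s :: "'e \<Rightarrow> int" where s: "\<forall>x\<in>insert e R. \<bar>s x\<bar> = 1"
          "\<And>v. (\<Sum>x\<in>insert e R. s x * (of_bool (t x = v) - of_bool (h' x = v))) = 0"
        using less.hyps[of "insert e R" h'] R f by auto
      \<comment> \<open>Undoing the splitting, \<open>f\<close> carries on the flow of
        \<open>e\<close> from \<open>h e\<close> to \<open>b\<close>; the factor \<sigma> corrects
        for the direction of \<open>f\<close>.\<close>
      define s' where "s' = s(f := s e * \<sigma>)"
      have "(\<Sum>x\<in>F. s' x * (of_bool (t x = v) - of_bool (h x = v))) = 0" for v
      proof -
        have "(\<Sum>x\<in>R. s' x * (of_bool (t x = v) - of_bool (h x = v))) =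
              (\<Sum>x\<in>R. s x * (of_bool (t x = v) - of_bool (h' x = v)))"
          by (rule sum.cong) (use R in \<open>auto simp: h'R s'_def\<close>)
        moreover have "\<sigma> * (of_bool (t f = v) - of_bool (h f = v)) = of_bool (h e = v) - of_bool (b = v)"
          using f by (auto simp: \<sigma>_def b_def)
        then have "s' f * (of_bool (t f = v) - of_bool (h f = v)) =
            s e * (of_bool (h e = v) - of_bool (b = v))"
          by (simp add: s'_def mult.assoc)
        ultimately show ?thesis
          using s(2)[of v] R f by (simp add: s'_def h'_def algebra_simps)
      qed
      moreover have "\<forall>x\<in>F. \<bar>s' x\<bar> = 1"
        using s(1) R by (auto simp: s'_def \<sigma>_def abs_mult)
      ultimately show ?thesis by blast
    qed
  qed simp
qed

text \<open>Modulo 2 the direction of an edge is irrelevant, so conservation of \<open>f\<close>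
  becomes evenness of the set where \<open>f\<close> is odd.\<close>

lemma even_set_odd_part:
  fixes f :: "'e \<Rightarrow> int"
  assumes "finite E" and or: "\<And>e. e \<in> E \<Longrightarrow> en e = Upair (t e) (h e)"
    and net: "\<And>v. (\<Sum>e\<in>E. f e * (of_bool (t e = v) - of_bool (h e = v))) = 0"
  shows "even_set en {e \<in> E. odd (f e)}"
  unfolding even_set_def
proof
  fix v
  have "int (set_degree en {e \<in> E. odd (f e)} v) =
      (\<Sum>e\<in>E. of_bool (odd (f e)) * (of_bool (t e = v) + of_bool (h e = v)))"
    unfolding set_degree_def of_nat_sum
    by (rule sum.mono_neutral_cong_left) (auto simp: assms incidence_Upair)
  \<comment> \<open>Adding the net flow, which is zero, makes every single summand even.\<close>
  also have "\<dots> = (\<Sum>e\<in>E. of_bool (odd (f e)) * (of_bool (t e = v) + of_bool (h e = v))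
      + f e * (of_bool (t e = v) - of_bool (h e = v)))"
    by (simp add: sum.distrib net)
  also have "even \<dots>"
    by (intro dvd_sum) auto
  finally show "even (set_degree en {e \<in> E. odd (f e)} v)" by simp
qed

text \<open>This lifts a flow modulo 2 to an integer flow for a prescribed orientation: a balanced
  signing of \<open>X\<close>, extended by zero.\<close>

lemma even_set_unit_flow:
  assumes "finite E" "X \<subseteq> E" and or: "\<And>e. e \<in> E \<Longrightarrow> en e = Upair (t e) (h e)"
    and "even_set en X"
  obtains g :: "'e \<Rightarrow> int" where "\<And>e. e \<in> X \<Longrightarrow> \<bar>g e\<bar> = 1" "\<And>e. e \<notin> X \<Longrightarrow> g e = 0"
    "\<And>v. (\<Sum>e\<in>E. g e * (of_bool (t e = v) - of_bool (h e = v))) = 0"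
proof -
  have "set_degree en X v = (\<Sum>e\<in>X. of_bool (t e = v) + of_bool (h e = v))" for v
    unfolding set_degree_def
    by (rule sum.cong) (use assms in \<open>auto simp: incidence_Upair subset_iff\<close>)
  then have "\<forall>v. even (\<Sum>e\<in>X. of_bool (t e = v) + of_bool (h e = v) :: nat)"
    using assms(4) unfolding even_set_def by metis
  then obtain s :: "'e \<Rightarrow> int" where s: "\<forall>e\<in>X. \<bar>s e\<bar> = 1"
      "\<And>v. (\<Sum>e\<in>X. s e * (of_bool (t e = v) - of_bool (h e = v))) = 0"
    using even_balanced_signing[of X t h] finite_subset[OF assms(2,1)] by blast
  show thesis
  proof (rule that[of "\<lambda>e. if e \<in> X then s e else 0"])
    fix v
    have "(\<Sum>e\<in>E. (if e \<in> X then s e else 0) * (of_bool (t e = v) - of_bool (h e = v))) =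
        (\<Sum>e\<in>X. s e * (of_bool (t e = v) - of_bool (h e = v)))"
      by (rule sum.mono_neutral_cong_right) (use assms in auto)
    then show "(\<Sum>e\<in>E. (if e \<in> X then s e else 0) * (of_bool (t e = v) - of_bool (h e = v))) = 0"
      using s(2) by simp
  qed (use s in auto)
qed

text \<open>The right-hand form is linear in \<open>f\<close>, so flows can be added, scaled and
  halved edge by edge.\<close>

lemma flow_conservation_iff:
  fixes f :: "'e \<Rightarrow> int"
  assumes "finite E"
  shows "(\<Sum>e | e \<in> E \<and> t e = v. f e) = (\<Sum>e | e \<in> E \<and> h e = v. f e) \<longleftrightarrow>
    (\<Sum>e\<in>E. f e * (of_bool (t e = v) - of_bool (h e = v))) = 0"
proof -
  have "(\<Sum>e | e \<in> E \<and> k e = v. f e) = (\<Sum>e\<in>E. f e * of_bool (k e = v))" for k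
    by (rule sum.mono_neutral_cong_left) (use assms in auto)
  then show ?thesis
    by (simp add: right_diff_distrib sum_subtractf)
qed

text \<open>From a flow \<open>f\<close>, one even set is where \<open>f\<close> is odd; adding a
  unit flow on it and halving gives a second flow, which is odd wherever \<open>f\<close> is 2 or
  -2. Conversely, unit flows \<open>x\<close> and \<open>y\<close> on the two sets combine to
  \<open>x + 2y\<close>.\<close>

lemma nowhere_zero_4_flow_iff_even_sets:
  assumes "is_graph G"
  shows "nowhere_zero_flow 4 G \<longleftrightarrow>
    (\<exists>X Y. even_set (ends G) X \<and> even_set (ends G) Y \<and> X \<union> Y = edges G)"
proof
  have fin: "finite (edges G)" using assms by (simp add: is_graph_def)
  {
    assume "nowhere_zero_flow 4 G"
    then obtain t h and f :: "'b \<Rightarrow> int" where or: "orientation G t h"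
      and nz: "\<And>e. e \<in> edges G \<Longrightarrow> 0 < \<bar>f e\<bar> \<and> \<bar>f e\<bar> < 4"
      and cons: "\<And>v. v \<in> verts G \<Longrightarrow>
        (\<Sum>e\<in>edges G. f e * (of_bool (t e = v) - of_bool (h e = v))) = 0"
      unfolding nowhere_zero_flow_def flow_conservation_iff[OF fin] of_nat_numeral by blast
    have or: "\<And>e. e \<in> edges G \<Longrightarrow> ends G e = Upair (t e) (h e)"
      using or by (simp add: orientation_def)
    have in_verts: "t e \<in> verts G" "h e \<in> verts G" if "e \<in> edges G" for e
      using that or[OF that] assms by (auto simp: is_graph_def)
    \<comment> \<open>Conservation is known only at the vertices of \<open>G\<close>, whereas
      evenness concerns the whole type; elsewhere no edge has an end.\<close>
    have net_f: "(\<Sum>e\<in>edges G. f e * (of_bool (t e = v) - of_bool (h e = v))) = 0" for v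
    proof (cases "v \<in> verts G")
      case False
      then show ?thesis using in_verts by (intro sum.neutral) auto
    qed (use cons in auto)
    define X where "X = {e \<in> edges G. odd (f e)}"
    have X: "even_set (ends G) X"
      unfolding X_def by (rule even_set_odd_part[OF fin or net_f])
    obtain g :: "'b \<Rightarrow> int" where g: "\<And>e. e \<in> X \<Longrightarrow> \<bar>g e\<bar> = 1" "\<And>e. e \<notin> X \<Longrightarrow> g e = 0"
      and net_g: "\<And>v. (\<Sum>e\<in>edges G. g e * (of_bool (t e = v) - of_bool (h e = v))) = 0"
      using even_set_unit_flow[OF fin _ or X] unfolding X_def by blast
    define k where "k e = (f e + g e) div 2" for e
    have k: "2 * k e = f e + g e" if "e \<in> edges G" for e
    proof -
      have "even (f e + g e)"
      proof (cases "e \<in> X")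
        case True
        then have "g e = 1 \<or> g e = - 1" using g(1)[of e] by linarith
        then show ?thesis using True by (auto simp: X_def)
      qed (use that g in \<open>auto simp: X_def\<close>)
      then show ?thesis by (simp add: k_def)
    qed
    have "2 * (\<Sum>e\<in>edges G. k e * (of_bool (t e = v) - of_bool (h e = v))) =
        (\<Sum>e\<in>edges G. (f e + g e) * (of_bool (t e = v) - of_bool (h e = v)))" for v
      unfolding sum_distrib_left by (rule sum.cong) (auto simp: k[symmetric])
    then have "2 * (\<Sum>e\<in>edges G. k e * (of_bool (t e = v) - of_bool (h e = v))) = 0" for v
      unfolding distrib_right sum.distrib net_f net_g by simp
    then have net_k: "(\<Sum>e\<in>edges G. k e * (of_bool (t e = v) - of_bool (h e = v))) = 0" for v
      by simp
    have "even_set (ends G) {e \<in> edges G. odd (k e)}"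
      by (rule even_set_odd_part[OF fin or net_k])
    moreover have "odd (k e)" if "e \<in> edges G" "e \<notin> X" for e
    proof -
      have "even (f e)" using that by (simp add: X_def)
      then have "f e = 2 \<or> f e = - 2" using nz[OF that(1)] by presburger
      then have "k e = 1 \<or> k e = - 1" using k[OF that(1)] g(2)[OF that(2)] by auto
      then show ?thesis by auto
    qed
    then have "X \<union> {e \<in> edges G. odd (k e)} = edges G" by (auto simp: X_def)
    ultimately show "\<exists>X Y. even_set (ends G) X \<and> even_set (ends G) Y \<and> X \<union> Y = edges G"
      using X by blast
  }
  {
    assume "\<exists>X Y. even_set (ends G) X \<and> even_set (ends G) Y \<and> X \<union> Y = edges G"
    then obtain X Y where XY: "even_set (ends G) X" "even_set (ends G) Y" "X \<union> Y = edges G" by blast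
    have "\<forall>e. \<exists>a b. ends G e = Upair a b" by (metis uprod_exhaust)
    then obtain t h where or: "\<And>e. ends G e = Upair (t e) (h e)" unfolding choice_iff by blast
    obtain x :: "'b \<Rightarrow> int" where x: "\<And>e. e \<in> X \<Longrightarrow> \<bar>x e\<bar> = 1" "\<And>e. e \<notin> X \<Longrightarrow> x e = 0"
      "\<And>v. (\<Sum>e\<in>edges G. x e * (of_bool (t e = v) - of_bool (h e = v))) = 0"
      using even_set_unit_flow[OF fin _ or XY(1)] XY(3) by blast
    obtain y :: "'b \<Rightarrow> int" where y: "\<And>e. e \<in> Y \<Longrightarrow> \<bar>y e\<bar> = 1" "\<And>e. e \<notin> Y \<Longrightarrow> y e = 0"
      "\<And>v. (\<Sum>e\<in>edges G. y e * (of_bool (t e = v) - of_bool (h e = v))) = 0"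
      using even_set_unit_flow[OF fin _ or XY(2)] XY(3) by blast
    \<comment> \<open>\<open>x e\<close> and \<open>y e\<close> lie in {-1, 0, 1} and are not both
      0, so by parity the two terms cannot cancel.\<close>
    have "0 < \<bar>x e + 2 * y e\<bar> \<and> \<bar>x e + 2 * y e\<bar> < 4" if "e \<in> edges G" for e
    proof -
      have "\<bar>x e\<bar> = 1 \<or> x e = 0" "\<bar>y e\<bar> = 1 \<or> y e = 0" "\<bar>x e\<bar> = 1 \<or> \<bar>y e\<bar> = 1"
        using x y that XY(3) by blast+
      then show ?thesis by linarith
    qed
    moreover have "(\<Sum>e\<in>edges G. (x e + 2 * y e) * (of_bool (t e = v) - of_bool (h e = v))) = 0" for v
      using x(3)[of v] y(3)[of v]
      by (simp add: distrib_right sum.distrib mult.assoc flip: sum_distrib_left)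
    ultimately show "nowhere_zero_flow 4 G"
      unfolding nowhere_zero_flow_def flow_conservation_iff[OF fin] orientation_def
      using or by (intro exI[of _ t] exI[of _ h] exI[of _ "\<lambda>e. x e + 2 * y e"]) auto
  }
qed

section \<open>Two-regular subgraphs\<close>

lemma two_regular_subgraph_even_set:
  assumes "two_regular_subgraph H G"
  shows "even_set (ends G) (edges H)"
  unfolding even_set_def
proof
  fix v
  have H: "finite (edges H)" "ends H = ends G" "\<And>e. e \<in> edges H \<Longrightarrow> set_uprod (ends G e) \<subseteq> verts H"
    using assms unfolding two_regular_subgraph_def subgraph_def is_graph_def by metis+
  show "even (set_degree (ends G) (edges H) v)"
  proof (cases "v \<in> verts H")
    case True
    then show ?thesis
      using assms degree_eq_set_degree[OF H(1), of v] H(2)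
      by (simp add: two_regular_subgraph_def regular_def)
  next
    case False
    then have "set_degree (ends G) (edges H) v = 0"
      using H(1,3) by (fastforce simp: set_degree_def incidence_def)
    then show ?thesis by simp
  qed
qed

text \<open>An even degree that is at most 3 is 0 or 2; taking only the vertices of nonzero degree
  leaves a 2-regular graph.\<close>

lemma even_set_two_regular_subgraph:
  assumes "cubic_graph G" "F \<subseteq> edges G" "even_set (ends G) F"
  obtains H where "two_regular_subgraph H G" "edges H = F"
proof
  let ?H = "\<lparr>verts = {v \<in> verts G. set_degree (ends G) F v \<noteq> 0}, edges = F, ends = ends G\<rparr>"
  have G: "finite (edges G)" "finite (verts G)"
    "\<And>e. e \<in> edges G \<Longrightarrow> set_uprod (ends G e) \<subseteq> verts G"
    "\<And>v. v \<in> verts G \<Longrightarrow> set_degree (ends G) (edges G) v = 3"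
    using assms(1) degree_eq_set_degree[of G]
    by (auto simp: cubic_graph_def is_graph_def regular_def)
  have F: "finite F" using G(1) assms(2) finite_subset by blast
  have "set_degree (ends G) F v \<noteq> 0" if "e \<in> F" "v \<in> set_uprod (ends G e)" for e v
    using that F by (auto simp: set_degree_def incidence_def)
  moreover have "set_uprod (ends G e) \<subseteq> verts G" if "e \<in> F" for e
    using that G(3) assms(2) by blast
  ultimately have "subgraph ?H G"
    using G(2) F assms(2) by (simp add: subgraph_def is_graph_def subset_iff)
  moreover have "degree ?H v = 2" if "v \<in> verts ?H" for v
  proof -
    have "set_degree (ends G) F v \<le> 3"
      using that G(4) set_degree_mono[OF G(1) assms(2), of "ends G" v] by simp
    moreover have "even (set_degree (ends G) F v)" using assms(3) by (simp add: even_set_def)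
    moreover have "set_degree (ends G) F v \<noteq> 0" using that by simp
    ultimately have "set_degree (ends G) F v = 2" by (elim evenE) simp
    then show ?thesis using degree_eq_set_degree[of ?H v] F by simp
  qed
  ultimately show "two_regular_subgraph ?H G" by (simp add: two_regular_subgraph_def regular_def)
qed simp

text \<open>A loop, or two edges sharing a vertex, would already produce degree at least 2;
  monotonicity of the degree reduces to these one- and two-element subsets.\<close>

lemma matching_if_set_degree_le_1:
  assumes "is_graph G" "M \<subseteq> edges G" "\<And>v. v \<in> verts G \<Longrightarrow> set_degree (ends G) M v \<le> 1"
  shows "matching G M"
proof -
  have fin: "finite M" using assms by (meson finite_subset is_graph_def)
  have le: "set_degree (ends G) K v \<le> 1"
    if "K \<subseteq> M" "e \<in> K" "v \<in> set_uprod (ends G e)" for K e v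
  proof -
    have "v \<in> verts G" using that assms(1,2) unfolding is_graph_def by blast
    then show ?thesis using assms(3)[of v] set_degree_mono[OF fin that(1), of "ends G" v] by linarith
  qed
  have "ends G e \<noteq> Upair v v" if "e \<in> M" for e v
  proof
    assume loop: "ends G e = Upair v v"
    then have "set_degree (ends G) {e} v = 2" by (simp add: set_degree_def incidence_Upair)
    then show False using le[of "{e}" e v] that loop by simp
  qed
  moreover have "set_uprod (ends G e) \<inter> set_uprod (ends G f) = {}"
    if "e \<in> M" "f \<in> M" "e \<noteq> f" for e f
  proof (rule ccontr)
    assume "\<not> ?thesis"
    then obtain v where "v \<in> set_uprod (ends G e)" "v \<in> set_uprod (ends G f)" by blast
    moreover from this have "set_degree (ends G) {e, f} v \<ge> 2"
      using that by (simp add: set_degree_def incidence_def)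
    ultimately show False using le[of "{e, f}" e v] that by simp
  qed
  ultimately show ?thesis using assms(2) by (simp add: matching_def)
qed

section \<open>Cycle double covers with five members\<close>

text \<open>At a vertex of \<open>G\<close> the degrees of the five members sum to 6. If the
  intersection had degree at least 2 there, the other three members, which avoid it, would have an
  even degree below 2, hence 0, and \<open>A\<close> and \<open>B\<close> contribute at most 2
  each.\<close>

lemma cdc_intersection_matching:
  assumes "cubic_graph G" "cycle_double_cover G {#A, B, C, D, E#}"
  shows "matching G (edges A \<inter> edges B)"
proof (rule matching_if_set_degree_le_1)
  show "is_graph G" using assms(1) by (simp add: cubic_graph_def)
  have two: "two_regular_subgraph A G" "two_regular_subgraph B G" "two_regular_subgraph C G"
      "two_regular_subgraph D G" "two_regular_subgraph E G"
    and cover: "\<And>e. e \<in> edges G \<Longrightarrow> of_bool (e \<in> edges A) + of_bool (e \<in> edges B)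
      + of_bool (e \<in> edges C) + of_bool (e \<in> edges D) + of_bool (e \<in> edges E) = (2 :: nat)"
    using assms(2) by (auto simp: cycle_double_cover_def split: if_splits)
  have sub: "edges A \<subseteq> edges G" "edges B \<subseteq> edges G" "edges C \<subseteq> edges G"
      "edges D \<subseteq> edges G" "edges E \<subseteq> edges G"
    using two by (auto simp: two_regular_subgraph_def subgraph_def)
  show "edges A \<inter> edges B \<subseteq> edges G" using sub by blast
  have fin: "finite (edges G)" using assms(1) by (simp add: cubic_graph_def is_graph_def)
  fix v assume v: "v \<in> verts G"
  let ?d = "\<lambda>F. set_degree (ends G) F v"
  let ?M = "edges A \<inter> edges B"
  have d3: "?d (edges G) = 3"
    using assms(1) v degree_eq_set_degree[OF fin] by (simp add: cubic_graph_def regular_def)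
  have ev: "even (?d (edges H))" if "two_regular_subgraph H G" for H
    using two_regular_subgraph_even_set[OF that] by (simp add: even_set_def)
  have indicator_sum: "?d F = (\<Sum>e\<in>edges G. of_bool (e \<in> F) * incidence (ends G e) v)"
    if "F \<subseteq> edges G" for F
    unfolding set_degree_def by (rule sum.mono_neutral_cong_left) (use that fin in auto)
  \<comment> \<open>Double counting: every edge of \<open>G\<close> is counted by exactly two
    members.\<close>
  have "?d (edges A) + ?d (edges B) + ?d (edges C) + ?d (edges D) + ?d (edges E) =
    (\<Sum>e\<in>edges G. 2 * incidence (ends G e) v)"
    unfolding indicator_sum[OF sub(1)] indicator_sum[OF sub(2)] indicator_sum[OF sub(3)]
      indicator_sum[OF sub(4)] indicator_sum[OF sub(5)] sum.distrib[symmetric] distrib_right[symmetric]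
    by (rule sum.cong) (simp_all only: cover)
  then have total: "?d (edges A) + ?d (edges B) + ?d (edges C) + ?d (edges D) + ?d (edges E) = 6"
    using d3 by (simp add: set_degree_def flip: sum_distrib_left)
  show "?d ?M \<le> 1"
  proof (rule ccontr)
    assume "\<not> ?thesis"
    moreover have "?d (edges G - ?M) + ?d ?M = 3"
      using set_degree_Diff[OF fin, of ?M "ends G" v] sub d3 by auto
    ultimately have le1: "?d (edges G - ?M) \<le> 1" by linarith
    have zero: "?d (edges H) = 0"
      if "two_regular_subgraph H G" "edges H \<subseteq> edges G - ?M" for H
    proof -
      have "?d (edges H) \<le> 1"
        using le1 set_degree_mono[OF _ that(2), of "ends G" v] fin by simp
      then show ?thesis using ev[OF that(1)] by (auto simp: le_Suc_eq)
    qed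
    \<comment> \<open>An edge in both \<open>A\<close> and \<open>B\<close> is already covered
      twice.\<close>
    have "edges C \<subseteq> edges G - ?M" "edges D \<subseteq> edges G - ?M" "edges E \<subseteq> edges G - ?M"
      using sub(3-5) by (auto dest!: cover)
    then have "?d (edges C) = 0" "?d (edges D) = 0" "?d (edges E) = 0"
      using zero two by blast+
    moreover have "?d (edges H) \<le> 2" if "two_regular_subgraph H G" "edges H \<subseteq> edges G" for H
      using set_degree_mono[OF fin that(2), of "ends G" v] d3 ev[OF that(1)] by (elim evenE) simp
    then have "?d (edges A) \<le> 2" "?d (edges B) \<le> 2" using two sub by blast+
    ultimately show False using total by linarith
  qed
qed

theorem theorem1:
  fixes G C\<^sub>0 :: "('v, 'e) graph"
  assumes "cubic_graph G"
    and "two_regular_subgraph C\<^sub>0 G"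
  shows "(\<exists>S. k_cdc 5 G S \<and> contained_in_cdc C\<^sub>0 S) \<longleftrightarrow>
    (\<exists>M. matching G M \<and> nowhere_zero_flow 4 (delete_edges G M) \<and>
      (\<exists>C\<^sub>1 C\<^sub>2. two_regular_subgraph C\<^sub>1 G \<and> two_regular_subgraph C\<^sub>2 G \<and>
        M = edges C\<^sub>1 \<inter> edges C\<^sub>2 \<and> subgraph C\<^sub>0 C\<^sub>1))"
proof
  have fin: "finite (edges G)" using assms(1) by (simp add: cubic_graph_def is_graph_def)
  have del: "is_graph (delete_edges G M)" "ends (delete_edges G M) = ends G"
    "edges (delete_edges G M) = edges G - M" for M
    using assms(1) by (auto simp: delete_edges_def cubic_graph_def is_graph_def)
  have sub: "edges H \<subseteq> edges G" if "two_regular_subgraph H G" for H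
    using that by (simp add: two_regular_subgraph_def subgraph_def)
  have even_sum: "even_set (ends G) (sym_diff F K)"
    if "even_set (ends G) F" "even_set (ends G) K" "F \<subseteq> edges G" "K \<subseteq> edges G" for F K
    using that by (intro even_set_sym_diff) (auto intro: finite_subset[OF _ fin])
  {
    assume "\<exists>S. k_cdc 5 G S \<and> contained_in_cdc C\<^sub>0 S"
    then obtain S A where S: "cycle_double_cover G S" "size S = 5" "A \<in># S" and A: "subgraph C\<^sub>0 A"
      by (auto simp: k_cdc_def contained_in_cdc_def)
    \<comment> \<open>The member \<open>A\<close> that contains \<open>C\<^sub>0\<close> is singled
      out to serve as \<open>C\<^sub>1\<close>; any other member can serve as
      \<open>C\<^sub>2\<close>.\<close>
    obtain T where T: "S = add_mset A T" using S(3) by (metis multi_member_split)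
    then have "size T = Suc (Suc (Suc (Suc 0)))" using S(2) by simp
    then obtain B C D E where "T = {#B, C, D, E#}"
      by (elim size_mset_SucE) auto
    then have cdc: "cycle_double_cover G {#A, B, C, D, E#}" using S(1) T by simp
    then have two: "two_regular_subgraph A G" "two_regular_subgraph B G" "two_regular_subgraph C G"
      "two_regular_subgraph D G" "two_regular_subgraph E G"
      and cover: "\<And>e. e \<in> edges G \<Longrightarrow> of_bool (e \<in> edges A) + of_bool (e \<in> edges B)
      + of_bool (e \<in> edges C) + of_bool (e \<in> edges D) + of_bool (e \<in> edges E) = (2 :: nat)"
      by (auto simp: cycle_double_cover_def split: if_splits)
    let ?M = "edges A \<inter> edges B"
    let ?X = "sym_diff (edges C) (edges D)" and ?Y = "sym_diff (edges C) (edges E)"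
    have "even_set (ends G) ?X" "even_set (ends G) ?Y"
      using two by (auto intro!: even_sum two_regular_subgraph_even_set sub)
    \<comment> \<open>The union consists of the edges on which \<open>C\<close>, \<open>D\<close>
      and \<open>E\<close> do not all agree. No edge is in all three, and an edge of
      \<open>G\<close> is in none of them exactly if \<open>A\<close> and \<open>B\<close> cover it
      twice.\<close>
    moreover have "e \<in> ?X \<union> ?Y \<longleftrightarrow> e \<in> edges G - ?M" for e
    proof (cases "e \<in> edges G")
      case True
      then show ?thesis using cover[OF True] by (auto simp: of_bool_def split: if_splits)
    next
      case False
      then show ?thesis using two sub by blast
    qed
    then have "?X \<union> ?Y = edges G - ?M" by blast
    ultimately have "nowhere_zero_flow 4 (delete_edges G ?M)"
      unfolding nowhere_zero_4_flow_iff_even_sets[OF del(1)] del(2,3) by blast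
    with cdc_intersection_matching[OF assms(1) cdc] two(1,2) A
    show "\<exists>M. matching G M \<and> nowhere_zero_flow 4 (delete_edges G M) \<and>
      (\<exists>C\<^sub>1 C\<^sub>2. two_regular_subgraph C\<^sub>1 G \<and> two_regular_subgraph C\<^sub>2 G \<and>
        M = edges C\<^sub>1 \<inter> edges C\<^sub>2 \<and> subgraph C\<^sub>0 C\<^sub>1)"
      by blast
  }
  {
    assume "\<exists>M. matching G M \<and> nowhere_zero_flow 4 (delete_edges G M) \<and>
      (\<exists>C\<^sub>1 C\<^sub>2. two_regular_subgraph C\<^sub>1 G \<and> two_regular_subgraph C\<^sub>2 G \<and>
        M = edges C\<^sub>1 \<inter> edges C\<^sub>2 \<and> subgraph C\<^sub>0 C\<^sub>1)"
    then obtain C\<^sub>1 C\<^sub>2 where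
      flow: "nowhere_zero_flow 4 (delete_edges G (edges C\<^sub>1 \<inter> edges C\<^sub>2))"
      and two: "two_regular_subgraph C\<^sub>1 G" "two_regular_subgraph C\<^sub>2 G" and C\<^sub>0: "subgraph C\<^sub>0 C\<^sub>1"
      by blast
    obtain X Y where XY: "even_set (ends G) X" "even_set (ends G) Y"
        "X \<union> Y = edges G - edges C\<^sub>1 \<inter> edges C\<^sub>2"
      using flow unfolding nowhere_zero_4_flow_iff_even_sets[OF del(1)] del(2,3) by blast
    have sub_XY: "X \<subseteq> edges G" "Y \<subseteq> edges G" using XY(3) by blast+
    note sub_C = sub[OF two(1)] sub[OF two(2)]
    let ?D = "sym_diff (edges C\<^sub>1) (edges C\<^sub>2)"
    have D: "even_set (ends G) ?D" "?D \<subseteq> edges G"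
      using two sub_C by (auto intro!: even_sum two_regular_subgraph_even_set)
    obtain A where A: "two_regular_subgraph A G" "edges A = sym_diff X ?D"
      by (rule even_set_two_regular_subgraph[OF assms(1) _ even_sum[OF XY(1) D(1) sub_XY(1) D(2)]])
        (use sub_XY D(2) in blast)
    obtain B where B: "two_regular_subgraph B G" "edges B = sym_diff Y ?D"
      by (rule even_set_two_regular_subgraph[OF assms(1) _ even_sum[OF XY(2) D(1) sub_XY(2) D(2)]])
        (use sub_XY D(2) in blast)
    have XY_sum: "even_set (ends G) (sym_diff X Y)" "sym_diff X Y \<subseteq> edges G"
      using even_sum[OF XY(1,2) sub_XY] sub_XY by blast+
    obtain C where C: "two_regular_subgraph C G" "edges C = sym_diff (sym_diff X Y) ?D"
      by (rule even_set_two_regular_subgraph[OF assms(1) _ even_sum[OF XY_sum(1) D(1) XY_sum(2) D(2)]])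
        (use XY_sum(2) D(2) in blast)
    let ?S = "{#C\<^sub>1, C\<^sub>2, A, B, C#}"
    \<comment> \<open>On the intersection of \<open>C\<^sub>1\<close> and \<open>C\<^sub>2\<close>
      the sets \<open>X\<close>, \<open>Y\<close> and \<open>?D\<close> are all absent. Any other
      edge lies in exactly two of \<open>X\<close>, \<open>Y\<close>, \<open>X + Y\<close>. Off
      \<open>?D\<close> these are the two covering members; on \<open>?D\<close> membership is
      complemented, so one of \<open>A\<close>, \<open>B\<close>, \<open>C\<close> joins the one of
      \<open>C\<^sub>1\<close>, \<open>C\<^sub>2\<close> that has the edge.\<close>
    have "size {#H \<in># ?S. e \<in> edges H#} = 2" if "e \<in> edges G" for e
    proof -
      have "e \<in> X \<or> e \<in> Y \<longleftrightarrow> \<not> (e \<in> edges C\<^sub>1 \<and> e \<in> edges C\<^sub>2)" using XY(3) that by blast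
      then show ?thesis by (auto simp: A(2) B(2) C(2))
    qed
    then have "k_cdc 5 G ?S"
      using two A(1) B(1) C(1) by (auto simp: k_cdc_def cycle_double_cover_def)
    moreover have "contained_in_cdc C\<^sub>0 ?S" using C\<^sub>0 by (simp add: contained_in_cdc_def)
    ultimately show "\<exists>S. k_cdc 5 G S \<and> contained_in_cdc C\<^sub>0 S" by blast
  }
qed

end
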